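(* Let $n\ge1$ be an integer and let $\kappa$ be a complex number with positive real part. Then $$\frac{1}{n!}\int_{\Omega_n}D_n(x^2)\,D_n(x)\prod_{i=1}^n x_i^{\kappa-1}\,dx=\frac{2^{n(n-1)/2}\prod_{i=0}^{n-1}i!\,\Gamma(\kappa+2i)}{\Gamma\bigl(3n(n-1)/2+n\kappa+1\bigr)},$$ where $D_n(x)=\prod_{1\le i<j\le n}(x_i-x_j)$, $D_n(x^2)=\prod_{1\le i<j\le n}(x_i^2-x_j^2)$, and $\Omega_n=\{x=(x_i)_{1\le i\le n}\in\mathbb{R}^n\mid x_i\ge0,\ \sum_{i=1}^n x_i\le1\}$.
   Context: $dx=dx_1\cdots dx_n$ is Lebesgue measure on $\mathbb{R}^n$, $\Gamma$ is the Gamma function, and $x_i^{\kappa-1}=e^{(\kappa-1)\log x_i}$ with the real logarithm for $x_i>0$. The product on the right is over the product $i!\,\Gamma(\kappa+2i)$. *)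

theory Defs
  imports "HOL-Analysis.Analysis"
begin

text \<open>
  Points of \<open>n\<close>-dimensional Euclidean space are the functions on \<open>{1..n}\<close> (extensional outside
  this set), since the coordinates need an order and the dimension has to be a value, not a type.
  The Lebesgue measure is the \<open>n\<close>-fold product of the one-dimensional one.
\<close>

abbreviation lborel_n :: "nat \<Rightarrow> (nat \<Rightarrow> real) measure" where
  "lborel_n n \<equiv> Pi\<^sub>M {1..n} (\<lambda>_. lborel)"

definition diff_prod :: "nat \<Rightarrow> (nat \<Rightarrow> real) \<Rightarrow> real" where
  "diff_prod n x = (\<Prod>i\<in>{1..n}. \<Prod>j\<in>{i<..n}. x i - x j)"

definition Omega :: "nat \<Rightarrow> (nat \<Rightarrow> real) set" where
  "Omega n = {x \<in> {1..n} \<rightarrow>\<^sub>E UNIV. (\<forall>i\<in>{1..n}. 0 \<le> x i) \<and> (\<Sum>i=1..n. x i) \<le> 1}"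

text \<open>
  The complex power \<open>of_real t powr s\<close> is \<open>exp (s * of_real (ln t))\<close> for \<open>t > 0\<close>; its
  conventional value \<open>0\<close> at \<open>t = 0\<close> only matters on a null set.
\<close>

definition integrand :: "nat \<Rightarrow> complex \<Rightarrow> (nat \<Rightarrow> real) \<Rightarrow> complex" where
  "integrand n \<kappa> x =
     of_real (diff_prod n (\<lambda>i. (x i)\<^sup>2)) * of_real (diff_prod n x) *
     (\<Prod>i\<in>{1..n}. of_real (x i) powr (\<kappa> - 1))"

end

theory Submission
  imports Defs "Jordan_Normal_Form.Determinant"
begin

text \<open>
  The two difference products are Vandermonde determinants, so by the Leibniz formula the integrand
  is a signed sum of monomials \<open>\<Prod>i. x\<^sub>i powr (\<kappa> + 2 * \<sigma> i + \<tau> i - 1)\<close> over pairs of permutations. Each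
  is integrated over the simplex by Dirichlet's formula; the exponents have the same sum for all
  pairs, so the same Gamma factor appears in every denominator. The remaining sum is
  \<open>n!\<close> times the determinant of \<open>\<Gamma>(\<kappa> + 2i + j)\<close>. Since
  \<open>\<Gamma>(z + j) = \<Gamma>(z) pochhammer z j\<close> and \<open>pochhammer z j\<close> is a monic polynomial of degree \<open>j\<close> in \<open>z\<close>,
  this is again a Vandermonde determinant, at the nodes \<open>\<kappa> + 2i\<close>.
\<close>

hide_const (open) Determinants.det Module.smult

section \<open>Vandermonde determinants in a basis of monic polynomials\<close>

text \<open>The coefficients at \<open>n\<close> of \<open>q\<close> and of the scaled product
  cancel, so a nonzero difference would have degree below \<open>n\<close> and yet \<open>n\<close>
  distinct roots.\<close>

lemma monic_polynomial_with_roots_unique: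
  fixes q :: "'a::field poly"
  assumes deg: "degree q \<le> n" and inj: "inj_on y {..<n}" and roots: "\<And>i. i < n \<Longrightarrow> poly q (y i) = 0"
  shows "q = smult (coeff q n) (\<Prod>i<n. [:- y i, 1:])"
proof (rule ccontr)
  let ?P = "\<Prod>i<n. [:- y i, 1:]"
  define r where "r = q - smult (coeff q n) ?P"
  assume "q \<noteq> smult (coeff q n) ?P"
  then have r: "r \<noteq> 0" by (simp add: r_def)
  have degP: "degree ?P = n"
    by (subst degree_prod_eq_sum_degree) auto
  have "lead_coeff ?P = 1"
    by (simp add: lead_coeff_prod)
  then have cP: "coeff ?P n = 1" using degP by simp
  have "degree r \<le> n"
    unfolding r_def using deg degP by (intro degree_diff_le) (auto intro: order.trans[OF degree_smult_le])
  moreover have "coeff r n = 0" by (simp add: r_def cP)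
  ultimately have lt: "degree r < n"
    using r by (metis leading_coeff_0_iff le_neq_implies_less)
  have "n = card (y ` {..<n})" using inj by (simp add: card_image)
  also have "\<dots> \<le> card {x. poly r x = 0}"
    using r roots by (intro card_mono poly_roots_finite) (auto simp: r_def poly_prod)
  also have "\<dots> \<le> degree r" using r by (rule card_poly_roots_bound)
  finally show False using lt by simp
qed

text \<open>
  Expanding along the last row makes the determinant a polynomial in the last node \<open>t\<close>. It vanishes
  at the other nodes and its leading coefficient is the determinant of size \<open>n - 1\<close>.
\<close>

lemma det_vandermonde:
  fixes p :: "nat \<Rightarrow> 'a::field poly"
  assumes p: "\<And>k. k < n \<Longrightarrow> degree (p k) = k \<and> lead_coeff (p k) = 1"
  shows "det (mat n n (\<lambda>(i,j). poly (p j) (y i))) = (\<Prod>j<n. \<Prod>i<j. y j - y i)"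
  using p
proof (induction n)
  case 0
  show ?case by simp
next
  case (Suc n)
  define A where "A = (\<lambda>t. mat (Suc n) (Suc n) (\<lambda>(i,j). poly (p j) (if i = n then t else y i)))"
  have A: "A t \<in> carrier_mat (Suc n) (Suc n)" for t by (simp add: A_def)
  \<comment> \<open>Deleting row \<open>n\<close> removes the only row that depends on
    \<open>t\<close>, so evaluating these cofactors at \<open>t = 0\<close> is an arbitrary
    choice.\<close>
  define c where "c = (\<lambda>j. cofactor (A 0) n j)"
  have cof: "cofactor (A t) n j = c j" for t j
    unfolding c_def cofactor_def mat_delete_def A_def by (auto intro!: arg_cong[of _ _ det] eq_matI)
  define q where "q = (\<Sum>j<Suc n. smult (c j) (p j))"
  have q: "det (A t) = poly q t" for t
  proof -
    have "det (A t) = (\<Sum>j<Suc n. A t $$ (n, j) * c j)"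
      using laplace_expansion_row[OF A, of n t] by (simp only: cof)
    also have "\<dots> = poly q t"
      unfolding q_def poly_sum by (intro sum.cong refl) (simp add: A_def)
    finally show ?thesis .
  qed
  have "mat_delete (A 0) n n = mat n n (\<lambda>(i,j). poly (p j) (y i))"
    by (auto simp: mat_delete_def A_def intro!: eq_matI)
  then have cn: "c n = (\<Prod>j<n. \<Prod>i<j. y j - y i)"
    using Suc.IH[OF Suc.prems] by (simp only: c_def cofactor_def) simp
  have deg: "degree q \<le> n"
    unfolding q_def using Suc.prems
    by (intro degree_sum_le) (auto intro!: order.trans[OF degree_smult_le])
  have "coeff q n = (\<Sum>j<Suc n. if j = n then c n else 0)"
    unfolding q_def coeff_sum
  proof (intro sum.cong refl)
    fix j assume "j \<in> {..<Suc n}"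
    then show "coeff (smult (c j) (p j)) n = (if j = n then c n else 0)"
      using Suc.prems[of j] by (auto simp: coeff_eq_0)
  qed
  then have cq: "coeff q n = c n" by simp
  have Ay: "A (y n) = mat (Suc n) (Suc n) (\<lambda>(i,j). poly (p j) (y i))"
    by (auto simp: A_def intro!: eq_matI)
  have roots: "poly q (y i) = 0" if "i < n" for i
    unfolding q[symmetric] using that
    by (intro det_identical_rows[OF A, of i n]) (auto simp: A_def intro!: eq_vecI)
  have "poly q (y n) = c n * (\<Prod>i<n. y n - y i)"
  \<comment> \<open>Counting roots needs distinct nodes. If two of the first \<open>n\<close> nodes
    agree, both sides vanish: the left as a determinant with equal rows, the right because
    \<open>c n\<close> contains a factor \<open>y k - y l = 0\<close>.\<close>
  proof (cases "inj_on y {..<n}")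
    case True
    from monic_polynomial_with_roots_unique[OF deg this roots]
    have "poly q (y n) = poly (smult (coeff q n) (\<Prod>i<n. [:- y i, 1:])) (y n)" by simp
    then show ?thesis by (simp add: cq poly_prod)
  next
    case False
    then obtain i j where ij: "i < n" "j < n" "i \<noteq> j" "y i = y j" by (auto simp: inj_on_def)
    have "det (A (y n)) = 0"
      using ij by (intro det_identical_rows[OF A, of i j]) (auto simp: A_def intro!: eq_vecI)
    moreover have "\<exists>k<n. \<exists>l<k. y k - y l = 0"
      using ij by (metis linorder_neqE_nat eq_iff_diff_eq_0)
    then have "c n = 0" unfolding cn by (auto simp: prod_zero_iff)
    ultimately show ?thesis by (simp add: q)
  qed
  then show ?case by (simp add: cn q[symmetric] Ay)
qed

text \<open>Serves three times: with monomials for each of the two difference products, and with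
  Pochhammer polynomials for the Gamma values.\<close>

lemma leibniz_vandermonde:
  fixes p :: "nat \<Rightarrow> 'a::field poly"
  assumes "\<And>k. k < n \<Longrightarrow> degree (p k) = k \<and> lead_coeff (p k) = 1"
  shows "(\<Sum>\<sigma> | \<sigma> permutes {0..<n}. signof \<sigma> * (\<Prod>i=0..<n. poly (p (\<sigma> i)) (y i))) =
    (\<Prod>j<n. \<Prod>i<j. y j - y i)"
proof -
  have "(\<Sum>\<sigma> | \<sigma> permutes {0..<n}. signof \<sigma> * (\<Prod>i=0..<n. poly (p (\<sigma> i)) (y i))) =
     det (mat n n (\<lambda>(i,j). poly (p j) (y i)))"
    by (subst det_def'[of _ n]) (auto intro!: sum.cong prod.cong simp: permutes_in_image)
  then show ?thesis by (simp only: det_vandermonde[OF assms])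
qed

section \<open>The determinant of Gamma values\<close>

lemma poly_pochhammer_monic:
  fixes k :: nat
  defines "P \<equiv> \<Prod>i<k. [:of_nat i, 1:] :: 'a::field poly"
  shows "poly P z = pochhammer z k" "degree P = k" "lead_coeff P = 1"
proof -
  show "poly P z = pochhammer z k"
    by (simp add: P_def poly_prod pochhammer_prod add.commute lessThan_atLeast0)
  show "degree P = k"
    unfolding P_def by (subst degree_prod_eq_sum_degree) auto
  show "lead_coeff P = 1"
    unfolding P_def by (simp add: lead_coeff_prod)
qed

text \<open>For fixed \<open>\<sigma>\<close> the inner sum is \<open>signof \<sigma>\<close> times
  the determinant with rows permuted by \<open>\<sigma>\<close>. The permuted rows give the same
  sign again, so each of the \<open>fact n\<close> inner sums is the unpermuted determinant.\<close>

lemma leibniz_pair_sum: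
  fixes g :: "nat \<Rightarrow> nat \<Rightarrow> 'a::{comm_ring_1,ring_char_0}"
  shows "(\<Sum>\<sigma> | \<sigma> permutes {0..<n}. \<Sum>\<tau> | \<tau> permutes {0..<n}.
      signof \<sigma> * signof \<tau> * (\<Prod>i=0..<n. g (\<sigma> i) (\<tau> i))) =
    fact n * (\<Sum>\<tau> | \<tau> permutes {0..<n}. signof \<tau> * (\<Prod>i=0..<n. g i (\<tau> i)))"
proof -
  define G where "G = mat n n (\<lambda>(i,j). g i j)"
  have G: "G \<in> carrier_mat n n" by (simp add: G_def)
  have in_range: "\<sigma> i < n" if "\<sigma> permutes {0..<n}" "i < n" for \<sigma> i
    using that permutes_in_image[of \<sigma> "{0..<n}" i] by simp
  have detG: "det G = (\<Sum>\<tau> | \<tau> permutes {0..<n}. signof \<tau> * (\<Prod>i=0..<n. g i (\<tau> i)))"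
    by (subst det_def'[OF G]) (auto simp: G_def in_range intro!: sum.cong prod.cong)
  have "(\<Sum>\<tau> | \<tau> permutes {0..<n}. signof \<sigma> * signof \<tau> * (\<Prod>i=0..<n. g (\<sigma> i) (\<tau> i))) = det G"
    if \<sigma>: "\<sigma> permutes {0..<n}" for \<sigma>
  proof -
    have "(\<Sum>\<tau> | \<tau> permutes {0..<n}. signof \<sigma> * signof \<tau> * (\<Prod>i=0..<n. g (\<sigma> i) (\<tau> i))) =
        signof \<sigma> * det (mat n n (\<lambda>(i,j). G $$ (\<sigma> i, j)))"
      by (subst det_def'[of _ n])
         (auto simp: G_def in_range \<sigma> sum_distrib_left mult.assoc intro!: sum.cong prod.cong)
    also have "\<dots> = signof \<sigma> * signof \<sigma> * det G"
      by (simp add: det_permute_rows[OF G \<sigma>] mult.assoc)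
    also have "signof \<sigma> * signof \<sigma> = (1 :: 'a)"
      by (simp add: sign_def)
    finally show ?thesis by simp
  qed
  then have "(\<Sum>\<sigma> | \<sigma> permutes {0..<n}. \<Sum>\<tau> | \<tau> permutes {0..<n}.
      signof \<sigma> * signof \<tau> * (\<Prod>i=0..<n. g (\<sigma> i) (\<tau> i))) =
     (\<Sum>\<sigma> | \<sigma> permutes {0..<n}. det G)"
    by (intro sum.cong) auto
  also have "\<dots> = fact n * det G"
    using card_permutations[of "{0..<n}" n] by simp
  finally show ?thesis by (simp add: detG)
qed

lemma not_nonpos_Int_of_Re_pos: "Re z > 0 \<Longrightarrow> z \<notin> \<int>\<^sub>\<le>\<^sub>0"
  by (auto elim!: nonpos_Ints_cases)

text \<open>Row \<open>i\<close> has the common factor \<open>Gamma (y i)\<close>, which leaves a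
  Vandermonde determinant. The nodes are spaced by 2, so the differences \<open>2 * (j - i)\<close>
  with \<open>i < j\<close> multiply to \<open>2 ^ j * fact j\<close>.\<close>

lemma leibniz_Gamma:
  fixes \<kappa> :: complex
  assumes "Re \<kappa> > 0"
  shows "(\<Sum>\<tau> | \<tau> permutes {0..<n}. signof \<tau> *
      (\<Prod>i=0..<n. Gamma (\<kappa> + 2 * of_nat i + of_nat (\<tau> i)))) =
    2 ^ (n * (n - 1) div 2) * (\<Prod>i=0..<n. fact i * Gamma (\<kappa> + 2 * of_nat i))"
proof -
  define p where "p = (\<lambda>k. \<Prod>i<k. [:of_nat i, 1:] :: complex poly)"
  define y where "y = (\<lambda>i. \<kappa> + 2 * of_nat i)"
  have Gy: "Gamma (y i + of_nat k) = Gamma (y i) * poly (p k) (y i)" for i k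
  proof -
    have "Re (y i) > 0" using assms by (simp add: y_def)
    then have "y i \<notin> \<int>\<^sub>\<le>\<^sub>0" by (rule not_nonpos_Int_of_Re_pos)
    then show ?thesis
      by (simp add: p_def poly_pochhammer_monic pochhammer_Gamma Gamma_eq_zero_iff)
  qed
  have "(\<Sum>\<tau> | \<tau> permutes {0..<n}. signof \<tau> * (\<Prod>i=0..<n. Gamma (y i + of_nat (\<tau> i)))) =
     (\<Prod>i=0..<n. Gamma (y i)) *
     (\<Sum>\<tau> | \<tau> permutes {0..<n}. signof \<tau> * (\<Prod>i=0..<n. poly (p (\<tau> i)) (y i)))"
    by (simp add: Gy prod.distrib sum_distrib_left mult.left_commute)
  also have "(\<Sum>\<tau> | \<tau> permutes {0..<n}. signof \<tau> * (\<Prod>i=0..<n. poly (p (\<tau> i)) (y i))) =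
      (\<Prod>j<n. \<Prod>i<j. y j - y i)"
    by (rule leibniz_vandermonde) (simp add: p_def poly_pochhammer_monic(2) poly_pochhammer_monic(3)[simplified poly_pochhammer_monic(2)])
  also have "\<dots> = (\<Prod>j<n. 2 ^ j * fact j)"
  proof (intro prod.cong refl)
    fix j :: nat
    have "(\<Prod>i<j. y j - y i) = (\<Prod>i<j. 2 * of_nat (j - i))"
      by (intro prod.cong) (auto simp: y_def of_nat_diff algebra_simps)
    also have "\<dots> = 2 ^ j * (\<Prod>i<j. of_nat (j - i))"
      by (simp only: prod.distrib prod_constant card_lessThan)
    also have "(\<Prod>i<j. of_nat (j - i)) = (fact j :: complex)"
      by (simp add: fact_prod_rev lessThan_atLeast0)
    finally show "(\<Prod>i<j. y j - y i) = 2 ^ j * fact j" .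
  qed
  also have "\<dots> = 2 ^ (\<Sum>j<n. j) * (\<Prod>j<n. fact j)"
    by (simp add: prod.distrib power_sum)
  also have "(\<Sum>j<n. j) = n * (n - 1) div 2"
    using Sum_Ico_nat[of 0 n] by (simp add: lessThan_atLeast0)
  finally show ?thesis
    by (simp add: y_def prod.distrib lessThan_atLeast0 mult_ac)
qed

section \<open>Gamma and exponential integrals as Bochner integrals\<close>

text \<open>The power is \<open>0\<close> at \<open>t = 0\<close>, so the half-line may be taken
  open, and there the power is an exponential of \<open>ln t\<close>.\<close>

lemma borel_measurable_complex_powr [measurable]:
  "(\<lambda>t. indicator {0..} t *\<^sub>R of_real t powr (s::complex)) \<in> borel_measurable borel"
proof -
  have "(\<lambda>t. indicator {0<..} t *\<^sub>R exp (s * of_real (ln t))) \<in> borel_measurable borel"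
    by measurable
  also have "(\<lambda>t. indicator {0<..} t *\<^sub>R exp (s * of_real (ln t))) =
      (\<lambda>t. indicator {0..} t *\<^sub>R of_real t powr s)"
    by (auto simp: fun_eq_iff indicator_def powr_def Ln_of_real)
  finally show ?thesis .
qed

text \<open>Absolute integrability refers to the completed measure. Borel measurability brings it
  down to \<open>lborel\<close>, where the gauge integral gives the value.\<close>

lemma has_bochner_integral_lborel_of_absolutely:
  fixes f :: "real \<Rightarrow> 'a::euclidean_space"
  assumes meas: "(\<lambda>x. indicator S x *\<^sub>R f x) \<in> borel_measurable borel"
    and abs: "f absolutely_integrable_on S" and int: "(f has_integral I) S"
  shows "has_bochner_integral lborel (\<lambda>x. indicator S x *\<^sub>R f x) I"
proof -
  have m: "(\<lambda>x. indicator S x *\<^sub>R f x) \<in> borel_measurable lborel" using meas by simp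
  have 1: "set_integrable lborel S f"
    using abs integrable_completion[OF m] unfolding set_integrable_def by simp
  have "integral\<^sup>L lborel (\<lambda>x. indicator S x *\<^sub>R f x) = integral S f"
    using set_borel_integral_eq_integral(2)[OF 1] by (simp add: set_lebesgue_integral_def)
  then show ?thesis
    using 1 int by (simp add: has_bochner_integral_iff set_integrable_def integral_unique)
qed

lemma has_bochner_integral_Gamma:
  assumes "Re a > 0"
  shows "has_bochner_integral lborel
    (\<lambda>t. indicator {0..} t *\<^sub>R (of_real t powr (a - 1) * of_real (exp (- t)))) (Gamma a)"
proof -
  let ?f = "\<lambda>t. of_real t powr (a - 1) / of_real (exp t) :: complex"
  have eq: "(\<lambda>t. indicator {0<..} t *\<^sub>R ?f t) =
     (\<lambda>t. indicator {0..} t *\<^sub>R of_real t powr (a - 1) * of_real (exp (- t)))"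
    by (auto simp: fun_eq_iff indicator_def exp_minus divide_inverse)
  have "has_bochner_integral lborel (\<lambda>t. indicator {0<..} t *\<^sub>R ?f t) (Gamma a)"
    by (intro has_bochner_integral_lborel_of_absolutely absolutely_integrable_Gamma_integral'
        Gamma_integral_complex' assms) (unfold eq, measurable)
  then show ?thesis unfolding eq by simp
qed

lemma has_bochner_integral_exp_tail:
  "has_bochner_integral lborel (\<lambda>t. indicator {s..} t * exp (- t)) (exp (- s) :: real)"
proof -
  have I: "((\<lambda>t. exp (- t)) has_integral exp (- s)) {s..}"
    using has_integral_exp_minus_to_infinity[of 1 s] by simp
  have "has_bochner_integral lborel (\<lambda>t. indicator {s..} t *\<^sub>R exp (- t)) (exp (- s))"
    using I
    by (intro has_bochner_integral_lborel_of_absolutely nonnegative_absolutely_integrable_1)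
       (auto simp: integrable_on_def)
  then show ?thesis by simp
qed

section \<open>Scaling of Lebesgue measure and Dirichlet's integral\<close>

interpretation lborel_product: product_sigma_finite "\<lambda>_. lborel :: real measure"
  by standard

text \<open>Boxes determine the product measure, and on a box each coordinate contributes one factor
  \<open>t\<close> by one-dimensional scaling.\<close>

lemma PiM_lborel_scale:
  fixes t :: real
  assumes "finite I" "t > 0"
  shows "PiM I (\<lambda>_. lborel) =
    density (distr (PiM I (\<lambda>_. lborel)) (PiM I (\<lambda>_. lborel)) (\<lambda>x. \<lambda>i\<in>I. t * x i)) (\<lambda>_. t ^ card I)"
proof (rule lborel_product.PiM_eqI[symmetric, OF assms(1)])
  let ?M = "PiM I (\<lambda>_. lborel :: real measure)"
  let ?s = "\<lambda>x. \<lambda>i\<in>I. t * x i"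
  have s[measurable]: "?s \<in> measurable ?M ?M" by measurable
  fix A :: "_ \<Rightarrow> real set" assume A: "\<And>i. i \<in> I \<Longrightarrow> A i \<in> sets lborel"
  have A': "(*) t -` A i \<in> sets lborel" if "i \<in> I" for i
    using measurable_sets[of "(*) t" borel borel "A i"] A[OF that] by simp
  have PA: "Pi\<^sub>E I A \<in> sets ?M" using A assms(1) by (intro sets_PiM_I_finite) auto
  have "?s -` Pi\<^sub>E I A \<inter> space ?M = Pi\<^sub>E I (\<lambda>i. (*) t -` A i)"
    by (auto simp: space_PiM PiE_def Pi_def extensional_def)
  then have "emeasure (distr ?M ?M ?s) (Pi\<^sub>E I A) = (\<Prod>i\<in>I. emeasure lborel ((*) t -` A i))"
    using A' PA assms(1) by (simp add: emeasure_distr lborel_product.emeasure_PiM)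
  moreover have "emeasure lborel (A i) = ennreal t * emeasure lborel ((*) t -` A i)" if "i \<in> I" for i
  proof -
    have "emeasure lborel (A i) = emeasure (density (distr lborel borel ((*) t)) (\<lambda>_. \<bar>t\<bar>)) (A i)"
      using lborel_distr_mult'[of t] assms(2) by simp
    also have "\<dots> = ennreal t * emeasure lborel ((*) t -` A i)"
      using A[OF that] assms(2) by (simp add: emeasure_density nn_integral_cmult_indicator emeasure_distr)
    finally show ?thesis .
  qed
  ultimately show "emeasure (density (distr ?M ?M ?s) (\<lambda>_. t ^ card I)) (Pi\<^sub>E I A) =
      (\<Prod>i\<in>I. emeasure lborel (A i))"
    using PA assms
    by (simp add: emeasure_density nn_integral_cmult_indicator prod.distrib ennreal_power)
qed simp

lemma integral_PiM_lborel_scale: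
  fixes f :: "('i \<Rightarrow> real) \<Rightarrow> 'a::{banach, second_countable_topology}"
  assumes "finite I" "t > 0" and f[measurable]: "f \<in> borel_measurable (PiM I (\<lambda>_. lborel))"
  shows "(\<integral>x. f x \<partial>PiM I (\<lambda>_. lborel)) = t ^ card I *\<^sub>R (\<integral>x. f (\<lambda>i\<in>I. t * x i) \<partial>PiM I (\<lambda>_. lborel))"
proof -
  let ?M = "PiM I (\<lambda>_. lborel :: real measure)"
  let ?s = "\<lambda>x. \<lambda>i\<in>I. t * x i"
  have "(\<integral>x. f x \<partial>?M) = (\<integral>x. f x \<partial>density (distr ?M ?M ?s) (\<lambda>_. t ^ card I))"
    using PiM_lborel_scale[OF assms(1,2)] by simp
  also have "\<dots> = (\<integral>x. t ^ card I *\<^sub>R f x \<partial>distr ?M ?M ?s)"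
    using assms(2) by (subst integral_density) auto
  also have "\<dots> = (\<integral>x. t ^ card I *\<^sub>R f (?s x) \<partial>?M)"
    by (subst integral_distr) auto
  finally show ?thesis by simp
qed

text \<open>
  Integrate \<open>f x * exp (- t)\<close> over the region \<open>\<Sigma> x \<le> t\<close>, where \<open>f\<close> is the monomial. Integrating first
  over \<open>t\<close> gives a product of Gamma integrals; integrating first over \<open>x\<close> gives, by homogeneity of \<open>f\<close>,
  the integral \<open>J\<close> over the unit simplex times \<open>Gamma (A + 1)\<close>.
\<close>

lemma dirichlet_integral:
  fixes a :: "'i \<Rightarrow> complex"
  assumes fin: "finite I" and ne: "I \<noteq> {}" and a: "\<And>i. i \<in> I \<Longrightarrow> Re (a i) > 0"
  defines "S \<equiv> {x \<in> I \<rightarrow>\<^sub>E UNIV. (\<forall>i\<in>I. 0 \<le> x i) \<and> (\<Sum>i\<in>I. x i) \<le> 1}"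
  shows "has_bochner_integral (PiM I (\<lambda>_. lborel))
    (\<lambda>x. indicator S x *\<^sub>R (\<Prod>i\<in>I. of_real (x i) powr (a i - 1)))
    ((\<Prod>i\<in>I. Gamma (a i)) / Gamma ((\<Sum>i\<in>I. a i) + 1))"
proof -
  let ?M = "PiM I (\<lambda>_. lborel :: real measure)"
  \<comment> \<open>With the indicator inside each factor, \<open>f\<close> is the monomial cut off
    to the orthant and still a product over the coordinates.\<close>
  define g where "g = (\<lambda>i t. indicator {0..} t *\<^sub>R (of_real t powr (a i - 1)) :: complex)"
  define f where "f = (\<lambda>x. \<Prod>i\<in>I. g i (x i))"
  define \<Sigma> where "\<Sigma> = (\<lambda>x. \<Sum>i\<in>I. x i :: real)"
  define A where "A = (\<Sum>i\<in>I. a i)"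
  have g_meas[measurable]: "g i \<in> borel_measurable borel" for i
    unfolding g_def by measurable
  have f_meas[measurable]: "f \<in> borel_measurable ?M"
    unfolding f_def by measurable
  have \<Sigma>_meas[measurable]: "\<Sigma> \<in> borel_measurable ?M"
    unfolding \<Sigma>_def by measurable
  \<comment> \<open>Some coordinate is at most \<open>0\<close>; its factor vanishes by the
    indicator if it is negative and by \<open>0 powr s = 0\<close> if it is zero. Later this gives
    \<open>F t = 0\<close> for \<open>t \<le> 0\<close>.\<close>
  have f_supp: "f x = 0" if "\<Sigma> x \<le> 0" for x
  proof -
    have "\<exists>i\<in>I. x i \<le> 0"
    proof (rule ccontr)
      assume "\<not> ?thesis"
      then have "\<Sigma> x > 0" unfolding \<Sigma>_def using fin ne by (intro sum_pos) auto
      with that show False by simp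
    qed
    then obtain i where "i \<in> I" "g i (x i) = 0" by (force simp: g_def indicator_def)
    then show ?thesis using fin by (auto simp: f_def prod_zero_iff)
  qed
  have f_exp: "f x * of_real (exp (- \<Sigma> x)) = (\<Prod>i\<in>I. g i (x i) * of_real (exp (- x i)))" for x
    using fin by (simp add: f_def \<Sigma>_def prod.distrib exp_sum flip: sum_negf)
  have g_int: "has_bochner_integral lborel (\<lambda>t. g i t * of_real (exp (- t))) (Gamma (a i))"
    if "i \<in> I" for i
    using has_bochner_integral_Gamma[OF a[OF that]] by (simp add: g_def)
  have f_exp_int: "integrable ?M (\<lambda>x. f x * of_real (exp (- \<Sigma> x)))"
    unfolding f_exp using g_int
    by (intro lborel_product.product_integrable_prod fin) (auto simp: has_bochner_integral_iff)
  have f_exp_integral: "(\<integral>x. f x * of_real (exp (- \<Sigma> x)) \<partial>?M) = (\<Prod>i\<in>I. Gamma (a i))"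
    unfolding f_exp using g_int
    by (subst lborel_product.product_integral_prod[OF fin]) (auto simp: has_bochner_integral_iff)

  define F where "F = (\<lambda>s x. indicator {..s} (\<Sigma> x) *\<^sub>R f x)"
  have F_meas[measurable]: "F s \<in> borel_measurable ?M" for s
    unfolding F_def by measurable
  \<comment> \<open>Where \<open>\<Sigma> x \<le> s\<close>, the factor
    \<open>exp (s - \<Sigma> x)\<close> is at least 1, so the integrable product of Gamma integrands
    dominates \<open>F s\<close> up to a constant.\<close>
  have F_int: "integrable ?M (F s)" for s
  proof (rule Bochner_Integration.integrable_bound)
    show "integrable ?M (\<lambda>x. of_real (exp s) * (f x * of_real (exp (- \<Sigma> x))))"
      using f_exp_int by simp
    show "AE x in ?M. norm (F s x) \<le> norm (of_real (exp s) * (f x * of_real (exp (- \<Sigma> x))))"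
    proof (rule AE_I2)
      fix x
      have "1 \<le> exp s * exp (- \<Sigma> x)" if "\<Sigma> x \<le> s"
        using that by (simp flip: exp_add)
      then show "norm (F s x) \<le> norm (of_real (exp s) * (f x * of_real (exp (- \<Sigma> x))))"
        using mult_left_mono[of 1 "exp s * exp (- \<Sigma> x)" "cmod (f x)"]
        by (auto simp: F_def norm_mult indicator_def mult.left_commute)
    qed
  qed simp
  define J where "J = (\<integral>x. F 1 x \<partial>?M)"
  \<comment> \<open>The Jacobian supplies one \<open>t\<close> per coordinate, which raises each
    exponent \<open>a i - 1\<close> to \<open>a i\<close>; hence the total is exactly
    \<open>A\<close>.\<close>
  have f_scale: "t ^ card I *\<^sub>R f (\<lambda>i\<in>I. t * x i) = of_real t powr A * f x" if "t > 0" for t x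
  proof -
    have g_scale: "of_real t * g i (t * u) = of_real t powr a i * g i u" for i u
      using that
      by (auto simp: g_def indicator_def zero_le_mult_iff powr_times_real powr_diff of_real_mult)
    have "t ^ card I *\<^sub>R f (\<lambda>i\<in>I. t * x i) = (\<Prod>i\<in>I. of_real t * g i (t * x i))"
      by (simp add: f_def prod.distrib scaleR_conv_of_real)
    also have "\<dots> = of_real t powr A * f x"
      using that by (simp add: g_scale prod.distrib f_def A_def powr_def exp_sum[OF fin] sum_distrib_right)
    finally show ?thesis .
  qed
  have F_integral: "(\<integral>x. F t x \<partial>?M) = of_real t powr A * J" if t: "t > 0" for t
  proof -
    have "\<Sigma> (\<lambda>i\<in>I. t * x i) = t * \<Sigma> x" for x
      by (simp add: \<Sigma>_def sum_distrib_left)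
    then have "t ^ card I *\<^sub>R F t (\<lambda>i\<in>I. t * x i) = of_real t powr A * F 1 x" for x
      using t f_scale[OF t, of x] by (auto simp: F_def indicator_def)
    then have "t ^ card I *\<^sub>R (\<integral>x. F t (\<lambda>i\<in>I. t * x i) \<partial>?M) = of_real t powr A * J"
      unfolding J_def by (simp flip: integral_scaleR_right integral_mult_right_zero)
    then show ?thesis
      by (subst integral_PiM_lborel_scale[OF fin t]) simp_all
  qed

  define h where "h = (\<lambda>(x, t). F t x * of_real (exp (- t)))"
  have h_eq: "h (x, t) = f x * of_real (indicator {\<Sigma> x..} t * exp (- t))" for x t
    by (auto simp: h_def F_def indicator_def)
  interpret M: finite_product_sigma_finite "\<lambda>_. lborel :: real measure" I
    by standard (rule fin)
  interpret P: pair_sigma_finite ?M "lborel :: real measure" ..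
  have h_meas: "h \<in> borel_measurable (?M \<Otimes>\<^sub>M lborel)"
  proof -
    have [measurable]: "(\<lambda>p. f (fst p)) \<in> borel_measurable (?M \<Otimes>\<^sub>M lborel)"
        "(\<lambda>p. \<Sigma> (fst p)) \<in> borel_measurable (?M \<Otimes>\<^sub>M lborel)"
      by (rule measurable_compose[OF measurable_fst f_meas] measurable_compose[OF measurable_fst \<Sigma>_meas])+
    have [measurable]: "snd \<in> borel_measurable (?M \<Otimes>\<^sub>M lborel)"
      using measurable_snd[of ?M "lborel :: real measure"] by simp
    have "(\<lambda>p. (if \<Sigma> (fst p) \<le> snd p then f (fst p) else 0) * of_real (exp (- snd p)))
        \<in> borel_measurable (?M \<Otimes>\<^sub>M lborel)"
      by measurable
    also have "(\<lambda>p. (if \<Sigma> (fst p) \<le> snd p then f (fst p) else 0) * of_real (exp (- snd p))) = h"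
      by (auto simp: h_def F_def fun_eq_iff)
    finally show ?thesis .
  qed
  have h_inner: "has_bochner_integral lborel (\<lambda>t. h (x, t)) (f x * of_real (exp (- \<Sigma> x)))" for x
    unfolding h_eq
    by (intro has_bochner_integral_mult_right has_bochner_integral_of_real has_bochner_integral_exp_tail)
  \<comment> \<open>The exponential is positive, so taking norms only replaces \<open>f x\<close> by
    its norm. The iterated integral of the norm is thus finite by \<open>f_exp_int\<close>, as
    Fubini requires.\<close>
  have h_norm: "has_bochner_integral lborel (\<lambda>t. norm (h (x, t))) (norm (f x * of_real (exp (- \<Sigma> x))))" for x
    unfolding h_eq norm_mult norm_of_real
    by (simp add: abs_mult) (intro has_bochner_integral_mult_right has_bochner_integral_exp_tail)
  have h_int: "integrable (?M \<Otimes>\<^sub>M lborel) h"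
  proof (rule P.Fubini_integrable[OF h_meas])
    show "integrable ?M (\<lambda>x. \<integral>t. norm (h (x, t)) \<partial>lborel)"
      using h_norm f_exp_int by (simp add: has_bochner_integral_iff)
    show "AE x in ?M. integrable lborel (\<lambda>t. h (x, t))"
      using h_inner by (simp add: has_bochner_integral_iff)
  qed
  have Apos: "Re A > 0"
    unfolding A_def using fin ne a by (simp add: sum_pos)
  have "(\<Prod>i\<in>I. Gamma (a i)) = (\<integral>x. (\<integral>t. h (x, t) \<partial>lborel) \<partial>?M)"
    using h_inner f_exp_integral by (simp add: has_bochner_integral_iff)
  also have "\<dots> = (\<integral>t. (\<integral>x. h (x, t) \<partial>?M) \<partial>lborel)"
    using P.Fubini_integral[of "\<lambda>x t. h (x, t)"] h_int by simp
  \<comment> \<open>The exponent is written \<open>A + 1 - 1\<close> to match the Gamma integral at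
    \<open>A + 1\<close>. For \<open>t \<le> 0\<close> both sides are \<open>0\<close>, including
    \<open>t = 0\<close> because \<open>0 powr A = 0\<close>.\<close>
  also have "(\<lambda>t. \<integral>x. h (x, t) \<partial>?M) =
      (\<lambda>t. indicator {0..} t *\<^sub>R (of_real t powr (A + 1 - 1) * of_real (exp (- t))) * J)"
  proof
    fix t :: real
    show "(\<integral>x. h (x, t) \<partial>?M) =
        indicator {0..} t *\<^sub>R (of_real t powr (A + 1 - 1) * of_real (exp (- t))) * J"
    proof (cases "t > 0")
      case True
      then show ?thesis by (simp add: h_def F_integral)
    next
      case False
      then have "F t x = 0" for x by (auto simp: F_def indicator_def f_supp)
      then show ?thesis using False by (auto simp: h_def indicator_def)
    qed
  qed
  also have "(\<integral>t. indicator {0..} t *\<^sub>R (of_real t powr (A + 1 - 1) * of_real (exp (- t))) * J \<partial>lborel) =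
     Gamma (A + 1) * J"
    using has_bochner_integral_Gamma[of "A + 1"] Apos
    by (simp only: integral_mult_left_zero) (simp add: has_bochner_integral_iff)
  finally have "J = (\<Prod>i\<in>I. Gamma (a i)) / Gamma (A + 1)"
    using Apos not_nonpos_Int_of_Re_pos[of "A + 1"] by (simp add: Gamma_eq_zero_iff field_simps)
  then have "has_bochner_integral ?M (F 1) ((\<Prod>i\<in>I. Gamma (a i)) / Gamma (A + 1))"
    using F_int[of 1] by (simp add: has_bochner_integral_iff J_def)
  \<comment> \<open>Membership in the space supplies the extensionality demanded by
    \<open>S\<close>; \<open>F 1\<close> encodes only the signs and the bound on the sum.\<close>
  moreover have "F 1 x = indicator S x *\<^sub>R (\<Prod>i\<in>I. of_real (x i) powr (a i - 1))"
    if "x \<in> space ?M" for x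
  proof (cases "\<forall>i\<in>I. 0 \<le> x i")
    case True
    then have "f x = (\<Prod>i\<in>I. of_real (x i) powr (a i - 1))"
      unfolding f_def g_def by (intro prod.cong) auto
    then show ?thesis
      using True that by (auto simp: F_def S_def \<Sigma>_def indicator_def space_PiM)
  next
    case False
    then obtain i where "i \<in> I" "g i (x i) = 0" by (force simp: g_def)
    then show ?thesis using fin False by (auto simp: F_def f_def S_def prod_zero_iff)
  qed
  ultimately show ?thesis
    unfolding A_def by (simp cong: has_bochner_integral_cong)
qed

section \<open>Expansion of the integrand and evaluation of the integral\<close>

text \<open>Each pair of indices reverses its sign once in either product, so the signs cancel.
  Exchanging the two products and shifting the indices to start at 0 gives the Vandermonde
  form.\<close>

lemma diff_prod_eq_vandermonde:
  "complex_of_real (diff_prod n (\<lambda>i. (x i)\<^sup>2)) * of_real (diff_prod n x) =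
    (\<Prod>j<n. \<Prod>i<j. of_real (x (Suc j)) ^ 2 - of_real (x (Suc i)) ^ 2) *
    (\<Prod>j<n. \<Prod>i<j. of_real (x (Suc j)) - of_real (x (Suc i)))"
proof -
  have "diff_prod n (\<lambda>i. (x i)\<^sup>2) * diff_prod n x =
     (\<Prod>i\<in>{1..n}. \<Prod>j\<in>{i<..n}. ((x j)\<^sup>2 - (x i)\<^sup>2) * (x j - x i))"
    by (auto simp: diff_prod_def simp flip: prod.distrib intro!: prod.cong)
       (simp add: algebra_simps)
  also have "\<dots> = (\<Prod>j\<in>{1..n}. \<Prod>i\<in>{1..<j}. ((x j)\<^sup>2 - (x i)\<^sup>2) * (x j - x i))"
    by (subst (1 2) prod.Sigma) (auto intro!: prod.reindex_bij_witness[of _ prod.swap prod.swap])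
  also have "\<dots> = (\<Prod>j<n. \<Prod>i<j. ((x (Suc j))\<^sup>2 - (x (Suc i))\<^sup>2) * (x (Suc j) - x (Suc i)))"
    by (simp only: One_nat_def prod.atLeast1_atMost_eq atLeastLessThanSuc_atLeastAtMost)
  finally show ?thesis
    by (simp only: of_real_mult[symmetric]) (simp add: prod.distrib)
qed

text \<open>Permutations act on \<open>{0..<n}\<close> and coordinates are numbered from 1, hence
  the shift \<open>i - 1\<close>. Keeping the indicator in every term puts it in the form of
  Dirichlet's integrand.\<close>

lemma Omega_leibniz_expansion:
  fixes \<kappa> :: complex
  defines "a \<equiv> \<lambda>\<sigma> \<tau> i. \<kappa> + 2 * of_nat (\<sigma> (i - 1)) + of_nat (\<tau> (i - 1))"
  shows "indicator (Omega n) x *\<^sub>R integrand n \<kappa> x =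
    (\<Sum>\<sigma> | \<sigma> permutes {0..<n}. \<Sum>\<tau> | \<tau> permutes {0..<n}. signof \<sigma> * signof \<tau> *
      (indicator (Omega n) x *\<^sub>R (\<Prod>i\<in>{1..n}. of_real (x i) powr (a \<sigma> \<tau> i - 1))))"
proof (cases "x \<in> Omega n")
  case True
  define y where "y = (\<lambda>i. complex_of_real (x (Suc i)))"
  have monomial: "(\<Prod>i=0..<n. poly (monom 1 (\<sigma> i)) ((y i)\<^sup>2)) * (\<Prod>i=0..<n. poly (monom 1 (\<tau> i)) (y i)) *
      (\<Prod>i\<in>{1..n}. of_real (x i) powr (\<kappa> - 1)) = (\<Prod>i\<in>{1..n}. of_real (x i) powr (a \<sigma> \<tau> i - 1))"
    for \<sigma> \<tau> :: "nat \<Rightarrow> nat"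
  proof -
    \<comment> \<open>Exponents add only for \<open>u \<noteq> 0\<close>; at \<open>u = 0\<close>
      both sides carry a power of zero and vanish, so the identity also holds on the boundary of the
      simplex.\<close>
    have "of_real u powr (\<kappa> + 2 * of_nat k + of_nat l - 1) =
      ((of_real u)\<^sup>2) ^ k * of_real u ^ l * of_real u powr (\<kappa> - 1)" for u :: real and k l :: nat
    proof (cases "u = 0")
      case False
      then have "of_real u powr (\<kappa> - 1 + of_nat (2 * k + l)) =
         of_real u powr (\<kappa> - 1) * of_real u ^ (2 * k + l)"
        using powr_nat'[of "of_real u :: complex" "2 * k + l"] by (simp only: powr_add) simp
      moreover have "(of_real u :: complex) ^ (2 * k + l) = ((of_real u)\<^sup>2) ^ k * of_real u ^ l"
        by (simp only: power_add power_mult)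
      ultimately show ?thesis by (simp add: algebra_simps)
    qed simp
    then show ?thesis
      by (simp add: a_def y_def poly_monom prod.atLeast1_atMost_eq lessThan_atLeast0 prod.distrib)
  qed
  have "integrand n \<kappa> x =
     (\<Sum>\<sigma> | \<sigma> permutes {0..<n}. signof \<sigma> * (\<Prod>i=0..<n. poly (monom 1 (\<sigma> i)) ((y i)\<^sup>2))) *
     (\<Sum>\<tau> | \<tau> permutes {0..<n}. signof \<tau> * (\<Prod>i=0..<n. poly (monom 1 (\<tau> i)) (y i))) *
     (\<Prod>i\<in>{1..n}. of_real (x i) powr (\<kappa> - 1))"
    unfolding integrand_def diff_prod_eq_vandermonde
    by (subst (1 2) leibniz_vandermonde) (simp_all add: degree_monom_eq y_def)
  also have "\<dots> = (\<Sum>\<sigma> | \<sigma> permutes {0..<n}. \<Sum>\<tau> | \<tau> permutes {0..<n}. signof \<sigma> * signof \<tau> *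
      (\<Prod>i\<in>{1..n}. of_real (x i) powr (a \<sigma> \<tau> i - 1)))"
    unfolding monomial[symmetric]
    by (simp add: sum_distrib_left sum_distrib_right mult_ac)
  finally show ?thesis using True by simp
qed simp

theorem theorem3:
  fixes n :: nat and \<kappa> :: complex
  assumes "n \<ge> 1" and "Re \<kappa> > 0"
  shows "set_integrable (lborel_n n) (Omega n) (integrand n \<kappa>) \<and>
    1 / fact n * (LINT x:Omega n|lborel_n n. integrand n \<kappa> x) =
      2 ^ (n * (n - 1) div 2) * (\<Prod>i=0..n - 1. fact i * Gamma (\<kappa> + 2 * of_nat i)) /
      Gamma (3 * of_nat n * (of_nat n - 1) / 2 + of_nat n * \<kappa> + 1)"
proof -
  define a where "a = (\<lambda>\<sigma> \<tau> (i::nat). \<kappa> + 2 * of_nat (\<sigma> (i - 1)) + of_nat (\<tau> (i - 1)))"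
  define D :: complex where "D = Gamma (3 * of_nat n * (of_nat n - 1) / 2 + of_nat n * \<kappa> + 1)"
  let ?P = "{\<sigma>. \<sigma> permutes {0..<n}}"
  \<comment> \<open>A permutation preserves the sum of the indices. \<open>\<sigma>\<close> enters
    the exponents with weight 2 and \<open>\<tau>\<close> with weight 1, which yields the
    coefficient 3 in \<open>D\<close>.\<close>
  have sum_perm: "(\<Sum>i<n. of_nat (\<sigma> i)) = (of_nat n * (of_nat n - 1) / 2 :: complex)"
    if "\<sigma> \<in> ?P" for \<sigma>
  proof -
    have "(\<Sum>i<n. \<sigma> i) = (\<Sum>i<n. i)"
      using sum.permute[of \<sigma> "{0..<n}" id] that by (simp add: o_def lessThan_atLeast0)
    then have "(\<Sum>i<n. of_nat (\<sigma> i)) = (\<Sum>i<n. of_nat i :: complex)"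
      by (simp flip: of_nat_sum)
    also have "\<dots> = of_nat n * (of_nat n - 1) / 2"
      by (induction n) (simp_all add: field_simps)
    finally show ?thesis .
  qed
  have dirichlet: "has_bochner_integral (lborel_n n)
      (\<lambda>x. indicator (Omega n) x *\<^sub>R (\<Prod>i\<in>{1..n}. of_real (x i) powr (a \<sigma> \<tau> i - 1)))
      ((\<Prod>i=0..<n. Gamma (\<kappa> + 2 * of_nat (\<sigma> i) + of_nat (\<tau> i))) / D)"
    if "\<sigma> \<in> ?P" "\<tau> \<in> ?P" for \<sigma> \<tau>
  proof -
    have "(\<Sum>i\<in>{1..n}. a \<sigma> \<tau> i) =
        of_nat n * \<kappa> + 2 * (\<Sum>i<n. of_nat (\<sigma> i)) + (\<Sum>i<n. of_nat (\<tau> i))"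
      by (simp add: a_def sum.atLeast1_atMost_eq sum.distrib sum_distrib_left)
    also have "\<dots> = 3 * of_nat n * (of_nat n - 1) / 2 + of_nat n * \<kappa>"
      by (simp only: sum_perm[OF that(1)] sum_perm[OF that(2)]) (simp add: field_simps)
    finally have "Gamma ((\<Sum>i\<in>{1..n}. a \<sigma> \<tau> i) + 1) = D" by (simp add: D_def)
    moreover have "(\<Prod>i\<in>{1..n}. Gamma (a \<sigma> \<tau> i)) =
        (\<Prod>i=0..<n. Gamma (\<kappa> + 2 * of_nat (\<sigma> i) + of_nat (\<tau> i)))"
      by (simp add: a_def prod.atLeast1_atMost_eq lessThan_atLeast0)
    moreover have "Re (a \<sigma> \<tau> i) > 0" for i
      using assms(2) by (simp add: a_def)
    ultimately show ?thesis
      using dirichlet_integral[of "{1..n}" "a \<sigma> \<tau>"] assms(1) by (simp add: Omega_def)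
  qed
  have "has_bochner_integral (lborel_n n)
     (\<lambda>x. \<Sum>\<sigma>\<in>?P. \<Sum>\<tau>\<in>?P. signof \<sigma> * signof \<tau> *
       (indicator (Omega n) x *\<^sub>R (\<Prod>i\<in>{1..n}. of_real (x i) powr (a \<sigma> \<tau> i - 1))))
     (\<Sum>\<sigma>\<in>?P. \<Sum>\<tau>\<in>?P. signof \<sigma> * signof \<tau> *
       ((\<Prod>i=0..<n. Gamma (\<kappa> + 2 * of_nat (\<sigma> i) + of_nat (\<tau> i))) / D))"
    by (intro has_bochner_integral_sum has_bochner_integral_mult_right dirichlet)
  then have "has_bochner_integral (lborel_n n) (\<lambda>x. indicator (Omega n) x *\<^sub>R integrand n \<kappa> x)
     (\<Sum>\<sigma>\<in>?P. \<Sum>\<tau>\<in>?P. signof \<sigma> * signof \<tau> *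
       ((\<Prod>i=0..<n. Gamma (\<kappa> + 2 * of_nat (\<sigma> i) + of_nat (\<tau> i))) / D))"
    by (rule has_bochner_integral_cong[THEN iffD2, rotated 3])
       (simp_all only: Omega_leibniz_expansion a_def)
  also have "(\<Sum>\<sigma>\<in>?P. \<Sum>\<tau>\<in>?P. signof \<sigma> * signof \<tau> *
       ((\<Prod>i=0..<n. Gamma (\<kappa> + 2 * of_nat (\<sigma> i) + of_nat (\<tau> i))) / D)) =
     (\<Sum>\<sigma>\<in>?P. \<Sum>\<tau>\<in>?P. signof \<sigma> * signof \<tau> *
       (\<Prod>i=0..<n. Gamma (\<kappa> + 2 * of_nat (\<sigma> i) + of_nat (\<tau> i)))) / D"
    by (simp add: sum_divide_distrib)
  also have "\<dots> = fact n * (2 ^ (n * (n - 1) div 2) * (\<Prod>i=0..<n. fact i * Gamma (\<kappa> + 2 * of_nat i))) / D"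
    using leibniz_pair_sum[where n = n and g = "\<lambda>i j. Gamma (\<kappa> + 2 * of_nat i + of_nat j)"]
    by (simp only: leibniz_Gamma[OF assms(2)])
  \<comment> \<open>For \<open>n = 0\<close> truncated subtraction would make the right-hand range
    contain \<open>0\<close>.\<close>
  also have "{0..<n} = {0..n - 1}" using assms(1) by auto
  finally show ?thesis
    by (simp add: set_integrable_def set_lebesgue_integral_def has_bochner_integral_iff D_def)
qed

end
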